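(* Let $D$ be a positive integer. Let $\mathcal{M}_{0,D}$ be the complex vector space of weight $0$ modular local polynomials with exceptional set $E_D$, and for a fundamental domain $\mathbb{F}$ for $\operatorname{SL}_2(\mathbb{Z})$ let $r_{\mathbb{F}}$ be the number of connected components of $\mathbb{H}\setminus E_D$ that have non-empty intersection with $\mathbb{F}$. Then $$\dim_{\mathbb{C}}\left(\mathcal{M}_{0,D}\right)=\min_{\mathbb{F}} r_{\mathbb{F}},$$ the minimum running over all fundamental domains $\mathbb{F}$ for $\operatorname{SL}_2(\mathbb{Z})$.
   Context: $\mathbb{H}$ is the complex upper half-plane, on which $\operatorname{SL}_2(\mathbb{Z})$ acts by Möbius transformations. A fundamental domain for $\operatorname{SL}_2(\mathbb{Z})$ means any set $\mathbb{F}\subset\mathbb{H}$ containing precisely one element of each $\operatorname{SL}_2(\mathbb{Z})$-orbit in $\mathbb{H}$ (no further conditions). Exceptional set: for a positive integer $D$, let $\mathcal{Q}_D$ be the set of integral binary quadratic forms $Q=[a,b,c]$ ($Q(X,Y)=aX^2+bXY+cY^2$, $a,b,c\in\mathbb{Z}$) of discriminant $b^2-4ac=D$. Put $S_Q:=\{\tau\in\mathbb{H} : a|\tau|^2+b\operatorname{Re}(\tau)+c=0\}$ and $E_D:=\bigcup_{Q\in\mathcal{Q}_D}S_Q$. The set $E_D$ is $\operatorname{SL}_2(\mathbb{Z})$-invariant and nowhere dense in $\mathbb{H}$. Local polynomials: let $E\subset\mathbb{H}$ be an $\operatorname{SL}_2(\mathbb{Z})$-invariant nowhere dense set. A function $\mathcal{P}:\mathbb{H}\to\mathbb{C}$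 is a local polynomial with exceptional set $E$ if for every connected component $\mathcal{C}\subset\mathbb{H}\setminus E$ there is a polynomial $P_{\mathcal{C}}$ (with complex coefficients) such that $\mathcal{P}(\tau)=P_{\mathcal{C}}(\tau)$ for all $\tau\in\mathcal{C}$. Average: for $\tau\in\mathbb{H}$ let $\mathscr{C}_\tau$ be the set of connected components $\mathcal{C}$ of $\mathbb{H}\setminus E$ with $\tau\in\mathcal{C}\cup\partial\mathcal{C}$, and, in the case of existence, put $$\mathcal{A}(\mathcal{P})(\tau):=\frac{1}{\#\mathscr{C}_\tau}\sum_{\mathcal{C}\in\mathscr{C}_\tau}\lim_{w\in\mathcal{C},\, w\to\tau}\mathcal{P}(w).$$ A function $\mathcal{P}:\mathbb{H}\to\mathbb{C}$ is a weight $0$ modular local polynomial with exceptional set $E$ if: (1) $\mathcal{P}(\gamma\tau)=\mathcal{P}(\tau)$ for all $\gamma\in\operatorname{SL}_2(\mathbb{Z})$ and $\tau\in\mathbb{H}$; (2) $\mathcal{P}$ is a local polynomial with exceptional set $E$; (3) the limits defining $\mathcal{A}(\mathcal{P})(\tau)$ exist for all $\tau\in\mathbb{H}$ and $\mathcal{P}=\mathcal{A}(\mathcal{P})$ on $\mathbb{H}$. *)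

theory Defs
  imports
    "HOL-Analysis.Analysis"
    "HOL-Computational_Algebra.Polynomial"
    "HOL-Library.Function_Algebras"
begin

definition upper_half_plane :: "complex set" (\<open>\<H>\<close>)
  where "\<H> = {\<tau>. Im \<tau> > 0}"

definition SL2Z :: "(int ^ 2 ^ 2) set"
  where "SL2Z = {\<gamma>. det \<gamma> = 1}"

definition mob :: "int ^ 2 ^ 2 \<Rightarrow> complex \<Rightarrow> complex"
  where "mob \<gamma> \<tau> =
    (of_int (\<gamma> $ 1 $ 1) * \<tau> + of_int (\<gamma> $ 1 $ 2)) /
    (of_int (\<gamma> $ 2 $ 1) * \<tau> + of_int (\<gamma> $ 2 $ 2))"

definition SL2Z_orbit :: "complex \<Rightarrow> complex set"
  where "SL2Z_orbit \<tau> = {mob \<gamma> \<tau> | \<gamma>. \<gamma> \<in> SL2Z}"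

definition fundamental_domain :: "complex set \<Rightarrow> bool"
  where "fundamental_domain F \<longleftrightarrow>
    F \<subseteq> \<H> \<and> (\<forall>\<tau>\<in>\<H>. \<exists>!w. w \<in> F \<and> w \<in> SL2Z_orbit \<tau>)"

text \<open>The triple \<open>(a, b, c)\<close> stands for the form \<open>a X\<^sup>2 + b X Y + c Y\<^sup>2\<close>.\<close>

definition quadratic_forms :: "int \<Rightarrow> (int \<times> int \<times> int) set"
  where "quadratic_forms D = {(a, b, c). b\<^sup>2 - 4 * a * c = D}"

definition geodesic :: "int \<times> int \<times> int \<Rightarrow> complex set"
  where "geodesic = (\<lambda>(a, b, c).
    {\<tau> \<in> \<H>. of_int a * (cmod \<tau>)\<^sup>2 + of_int b * Re \<tau> + of_int c = 0})"

definition exceptional_set :: "int \<Rightarrow> complex set"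
  where "exceptional_set D = (\<Union>Q\<in>quadratic_forms D. geodesic Q)"

definition local_polynomial :: "complex set \<Rightarrow> (complex \<Rightarrow> complex) \<Rightarrow> bool"
  where "local_polynomial E f \<longleftrightarrow>
    (\<forall>C\<in>components (\<H> - E). \<exists>p :: complex poly. \<forall>\<tau>\<in>C. f \<tau> = poly p \<tau>)"

definition adjacent_components :: "complex set \<Rightarrow> complex \<Rightarrow> complex set set"
  where "adjacent_components E \<tau> = {C \<in> components (\<H> - E). \<tau> \<in> C \<union> frontier C}"

text \<open>
  The filter \<open>at \<tau> within C\<close> omits \<open>\<tau>\<close> itself. The components of the complement of
  \<open>exceptional_set D\<close> are open and local polynomials are continuous on them, so this
  does not affect the limits. The points \<open>\<tau>\<close> considered lie in the open set \<open>\<H>\<close>,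
  where the frontier in the complex plane is the boundary relative to \<open>\<H>\<close>.
\<close>

definition average_exists :: "complex set \<Rightarrow> (complex \<Rightarrow> complex) \<Rightarrow> complex \<Rightarrow> bool"
  where "average_exists E f \<tau> \<longleftrightarrow>
    (\<forall>C\<in>adjacent_components E \<tau>. \<exists>l. (f \<longlongrightarrow> l) (at \<tau> within C))"

definition average :: "complex set \<Rightarrow> (complex \<Rightarrow> complex) \<Rightarrow> complex \<Rightarrow> complex"
  where "average E f \<tau> =
    (1 / of_nat (card (adjacent_components E \<tau>))) *
    (\<Sum>C\<in>adjacent_components E \<tau>. Lim (at \<tau> within C) f)"

definition modular_local_polynomial :: "complex set \<Rightarrow> (complex \<Rightarrow> complex) \<Rightarrow> bool"
  where "modular_local_polynomial E f \<longleftrightarrow>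
    (\<forall>\<gamma>\<in>SL2Z. \<forall>\<tau>\<in>\<H>. f (mob \<gamma> \<tau>) = f \<tau>) \<and>
    local_polynomial E f \<and>
    (\<forall>\<tau>\<in>\<H>. average_exists E f \<tau> \<and> f \<tau> = average E f \<tau>)"

text \<open>
  A function on \<open>\<H>\<close> is represented by its extension by zero to the complex plane;
  without this normalisation the arbitrary values outside \<open>\<H>\<close> would contribute
  to the dimension.
\<close>

definition M0 :: "int \<Rightarrow> (complex \<Rightarrow> complex) set"
  where "M0 D = {f. modular_local_polynomial (exceptional_set D) f \<and> (\<forall>\<tau>. \<tau> \<notin> \<H> \<longrightarrow> f \<tau> = 0)}"

interpretation complex_fun: vector_space "\<lambda>(c :: complex) (f :: complex \<Rightarrow> complex) \<tau>. c * f \<tau>"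
  by unfold_locales (auto simp: fun_eq_iff algebra_simps)

definition components_meeting :: "int \<Rightarrow> complex set \<Rightarrow> complex set set"
  where "components_meeting D F = {C \<in> components (\<H> - exceptional_set D). C \<inter> F \<noteq> {}}"

definition num_components :: "int \<Rightarrow> complex set \<Rightarrow> enat"
  where "num_components D F =
    (if finite (components_meeting D F) then enat (card (components_meeting D F)) else \<infinity>)"

end

theory Submission
  imports Defs
begin

text \<open>
  Call the connected components of \<open>\<H> - E\<^sub>D\<close> chambers. A modular local polynomial is constant on
  each chamber: invariance under \<open>\<tau> \<mapsto> -1/\<tau>\<close> gives \<open>p(\<tau>) = q(-1/\<tau>)\<close> with polynomials \<open>p\<close> and
  \<open>q\<close>, and a polynomial that stays bounded at infinity is constant
  (\<open>modular_local_polynomial_constant_on_chamber\<close>). Its values on chambers are constant along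
  \<open>SL\<^sub>2(\<int>)\<close>-orbits of chambers and, by the averaging condition, determine it everywhere. Conversely,
  every function on the set of chamber orbits extends by averaging to a modular local polynomial,
  because \<open>SL\<^sub>2(\<int>)\<close> permutes the chambers adjacent to the points of an orbit
  (\<open>M0_is_chamber_average\<close>, \<open>chamber_average_in_M0\<close>). The dimension is therefore the number of
  chamber orbits.

  This number is finite. Every orbit meets the region \<open>\<bar>Re \<tau>\<bar> \<le> 1/2\<close>, \<open>(Im \<tau>)\<^sup>2 \<ge> 3/4\<close>, and only
  finitely many geodesics meet that region. In the coordinates \<open>(Re \<tau>, \<bar>\<tau>\<bar>\<^sup>2)\<close> the region is convex
  and the geodesics are straight lines, so that a chamber that meets the region is determined by the
  sides of these lines on which it lies (\<open>finite_chambers_meeting_reduced_region\<close>).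

  Every fundamental domain meets every chamber orbit, so it meets at least as many chambers as there
  are orbits (\<open>num_components_ge\<close>). A fundamental domain is an arbitrary set of representatives, so
  one may fix one chamber in each orbit and represent each point off \<open>E\<^sub>D\<close> by a point of a fixed
  chamber. This domain meets no other chamber (\<open>ex_fundamental_domain_num_components_le\<close>), so the
  bound is attained.
\<close>

lemma mem_upper_half_plane [simp]: "\<tau> \<in> \<H> \<longleftrightarrow> Im \<tau> > 0"
  by (simp add: upper_half_plane_def)

section \<open>The action of the modular group\<close>

definition matrix2 :: "int \<Rightarrow> int \<Rightarrow> int \<Rightarrow> int \<Rightarrow> int ^ 2 ^ 2"
  where "matrix2 a b c d = vector [vector [a, b], vector [c, d]]"

lemma matrix2_nth [simp]:
  "matrix2 a b c d $ 1 $ 1 = a" "matrix2 a b c d $ 1 $ 2 = b"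
  "matrix2 a b c d $ 2 $ 1 = c" "matrix2 a b c d $ 2 $ 2 = d"
  by (simp_all add: matrix2_def)

lemma mem_SL2Z: "\<gamma> \<in> SL2Z \<longleftrightarrow> \<gamma>$1$1 * \<gamma>$2$2 - \<gamma>$1$2 * \<gamma>$2$1 = 1"
  by (simp add: SL2Z_def det_2)

lemma matrix2_in_SL2Z [simp]: "matrix2 a b c d \<in> SL2Z \<longleftrightarrow> a * d - b * c = 1"
  by (simp add: mem_SL2Z)

lemma SL2Z_mult: "\<gamma> \<in> SL2Z \<Longrightarrow> \<delta> \<in> SL2Z \<Longrightarrow> \<gamma> ** \<delta> \<in> SL2Z"
  by (simp add: SL2Z_def det_mul)

definition SL2Z_inverse :: "int ^ 2 ^ 2 \<Rightarrow> int ^ 2 ^ 2"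
  where "SL2Z_inverse \<gamma> = matrix2 (\<gamma>$2$2) (- (\<gamma>$1$2)) (- (\<gamma>$2$1)) (\<gamma>$1$1)"

lemma SL2Z_inverse_in_SL2Z: "\<gamma> \<in> SL2Z \<Longrightarrow> SL2Z_inverse \<gamma> \<in> SL2Z"
  by (simp add: SL2Z_inverse_def mem_SL2Z algebra_simps)

lemma SL2Z_inverse_inverse [simp]: "SL2Z_inverse (SL2Z_inverse \<gamma>) = \<gamma>"
  by (simp add: SL2Z_inverse_def vec_eq_iff forall_2)

lemma mob_denominator_nonzero:
  assumes "\<gamma> \<in> SL2Z" "\<tau> \<in> \<H>"
  shows "of_int (\<gamma>$2$1) * \<tau> + of_int (\<gamma>$2$2) \<noteq> 0"
proof
  assume *: "of_int (\<gamma>$2$1) * \<tau> + of_int (\<gamma>$2$2) = (0::complex)"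
  from arg_cong[OF *, of Im] assms have "\<gamma>$2$1 = 0" by simp
  with * have "\<gamma>$2$2 = 0" by simp
  with \<open>\<gamma>$2$1 = 0\<close> assms show False by (simp add: mem_SL2Z)
qed

lemma Im_mob:
  assumes "\<gamma> \<in> SL2Z"
  shows "Im (mob \<gamma> \<tau>) = Im \<tau> / (cmod (of_int (\<gamma>$2$1) * \<tau> + of_int (\<gamma>$2$2)))\<^sup>2"
proof -
  define a b c d where "a = real_of_int (\<gamma>$1$1)" "b = real_of_int (\<gamma>$1$2)"
    "c = real_of_int (\<gamma>$2$1)" "d = real_of_int (\<gamma>$2$2)"
  have det: "a * d - b * c = 1"
    using arg_cong[OF assms[unfolded mem_SL2Z], of real_of_int] by (simp add: a_b_c_d_def)
  have "Im (mob \<gamma> \<tau>) = Im ((of_real a * \<tau> + of_real b) * cnj (of_real c * \<tau> + of_real d))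
      / (cmod (of_real c * \<tau> + of_real d))\<^sup>2"
    unfolding mob_def a_b_c_d_def of_real_of_int_eq
    by (subst complex_div_cnj) (simp only: of_real_power[symmetric] Im_divide_of_real)
  also have "Im ((of_real a * \<tau> + of_real b) * cnj (of_real c * \<tau> + of_real d))
      = (a * d - b * c) * Im \<tau>"
    by (simp add: algebra_simps)
  finally show ?thesis unfolding det by (simp add: a_b_c_d_def)
qed

lemma mob_in_upper_half_plane:
  assumes "\<gamma> \<in> SL2Z" "\<tau> \<in> \<H>"
  shows "mob \<gamma> \<tau> \<in> \<H>"
  using mob_denominator_nonzero[OF assms] assms by (simp add: Im_mob)

lemma mob_mult:
  assumes "\<delta> \<in> SL2Z" "\<tau> \<in> \<H>"
  shows "mob (\<gamma> ** \<delta>) \<tau> = mob \<gamma> (mob \<delta> \<tau>)"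
proof -
  define u v :: complex where "u = of_int (\<delta>$1$1) * \<tau> + of_int (\<delta>$1$2)"
    "v = of_int (\<delta>$2$1) * \<tau> + of_int (\<delta>$2$2)"
  have v: "v \<noteq> 0" using mob_denominator_nonzero[OF assms] by (simp add: u_v_def)
  have "mob \<gamma> (u / v) = (of_int (\<gamma>$1$1) * u + of_int (\<gamma>$1$2) * v)
      / (of_int (\<gamma>$2$1) * u + of_int (\<gamma>$2$2) * v)"
    using v by (simp add: mob_def divide_simps)
  also have "\<dots> = mob (\<gamma> ** \<delta>) \<tau>"
    by (simp add: mob_def matrix_matrix_mult_def sum_2 u_v_def algebra_simps)
  finally show ?thesis by (simp add: mob_def u_v_def)
qed

lemma mob_inverse_left:
  assumes "\<gamma> \<in> SL2Z" "\<tau> \<in> \<H>"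
  shows "mob (SL2Z_inverse \<gamma>) (mob \<gamma> \<tau>) = \<tau>"
proof -
  have "SL2Z_inverse \<gamma> ** \<gamma> = mat 1"
    using assms(1)
    by (simp add: SL2Z_inverse_def vec_eq_iff forall_2 matrix_matrix_mult_def sum_2 mat_def
        mem_SL2Z algebra_simps)
  moreover have "mob (mat 1) \<tau> = \<tau>" by (simp add: mob_def mat_def)
  ultimately show ?thesis using mob_mult[OF assms, of "SL2Z_inverse \<gamma>"] by simp
qed

lemma isCont_mob:
  assumes "\<gamma> \<in> SL2Z" "\<tau> \<in> \<H>"
  shows "isCont (mob \<gamma>) \<tau>"
proof -
  have "isCont (\<lambda>\<tau>. (of_int (\<gamma>$1$1) * \<tau> + of_int (\<gamma>$1$2)) /
      (of_int (\<gamma>$2$1) * \<tau> + of_int (\<gamma>$2$2))) \<tau>"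
    using mob_denominator_nonzero[OF assms] by (intro continuous_intros)
  then show ?thesis by (simp add: mob_def[abs_def])
qed

lemma SL2Z_orbit_refl: "\<tau> \<in> SL2Z_orbit \<tau>"
  unfolding SL2Z_orbit_def by (auto intro!: exI[of _ "matrix2 1 0 0 1"] simp: mob_def)

lemma SL2Z_orbit_eq:
  assumes "\<tau> \<in> \<H>" "w \<in> SL2Z_orbit \<tau>"
  shows "SL2Z_orbit w = SL2Z_orbit \<tau>"
proof -
  have sub: "SL2Z_orbit (mob \<gamma> z) \<subseteq> SL2Z_orbit z" if "\<gamma> \<in> SL2Z" "z \<in> \<H>" for \<gamma> z
    using that by (fastforce simp: SL2Z_orbit_def mob_mult[symmetric] intro: SL2Z_mult)
  obtain \<gamma> where \<gamma>: "\<gamma> \<in> SL2Z" "w = mob \<gamma> \<tau>" using assms by (auto simp: SL2Z_orbit_def)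
  have "w \<in> \<H>" using \<gamma> assms mob_in_upper_half_plane by simp
  then have "SL2Z_orbit (mob (SL2Z_inverse \<gamma>) w) \<subseteq> SL2Z_orbit w"
    using \<gamma> by (intro sub SL2Z_inverse_in_SL2Z)
  then show ?thesis using sub[OF \<gamma>(1) assms(1)] \<gamma> assms mob_inverse_left by auto
qed

section \<open>Reduction theory\<close>

text \<open>
  The imaginary part of \<open>\<gamma>\<tau>\<close> depends only on the bottom row \<open>(c, d)\<close> of \<open>\<gamma>\<close>, and it is at least
  \<open>Im \<tau>\<close> only if \<open>\<bar>c\<tau> + d\<bar> \<le> 1\<close>, which bounds \<open>c\<close> and then \<open>d\<close>.
\<close>

lemma finite_Im_ge_in_orbit:
  assumes "\<tau> \<in> \<H>"
  shows "finite {Im (mob \<gamma> \<tau>) |\<gamma>. \<gamma> \<in> SL2Z \<and> Im (mob \<gamma> \<tau>) \<ge> Im \<tau>}" (is "finite ?V")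
proof -
  define M where "M = \<lceil>1 / Im \<tau>\<rceil>"
  define N where "N = \<lceil>1 + M * \<bar>Re \<tau>\<bar>\<rceil>"
  define h where "h = (\<lambda>(c::int, d::int). Im \<tau> / (cmod (of_int c * \<tau> + of_int d))\<^sup>2)"
  have "?V \<subseteq> h ` ({-M..M} \<times> {-N..N})"
  proof
    fix r assume "r \<in> ?V"
    then obtain \<gamma> where \<gamma>: "\<gamma> \<in> SL2Z" "r = Im (mob \<gamma> \<tau>)" "r \<ge> Im \<tau>" by auto
    define c d where "c = \<gamma>$2$1" "d = \<gamma>$2$2"
    define z where "z = of_int c * \<tau> + of_int d"
    have r: "r = h (c, d)" using \<gamma> by (simp add: h_def c_d_def Im_mob)
    have pos: "Im \<tau> > 0" using assms by simp
    have "z \<noteq> 0" using mob_denominator_nonzero[OF \<gamma>(1) assms] by (simp add: z_def c_d_def)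
    have "r = Im \<tau> / (cmod z)\<^sup>2" by (simp add: r h_def z_def)
    then have "r * (cmod z)\<^sup>2 = Im \<tau>" using \<open>z \<noteq> 0\<close> by simp
    then have "Im \<tau> * (cmod z)\<^sup>2 \<le> Im \<tau> * 1"
      using mult_right_mono[OF \<gamma>(3), of "(cmod z)\<^sup>2"] by simp
    then have "(cmod z)\<^sup>2 \<le> 1\<^sup>2" using pos by simp
    then have z1: "cmod z \<le> 1" by (rule power2_le_imp_le) simp
    have "\<bar>Im z\<bar> \<le> 1" using abs_Im_le_cmod[of z] z1 by linarith
    then have "\<bar>real_of_int c\<bar> * Im \<tau> \<le> 1" using pos by (simp add: z_def abs_mult)
    then have "\<bar>real_of_int c\<bar> \<le> 1 / Im \<tau>" using pos by (simp add: field_simps)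
    also have "\<dots> \<le> M" by (simp add: M_def)
    finally have c: "\<bar>c\<bar> \<le> M" by linarith
    have "\<bar>Re z\<bar> \<le> 1" using abs_Re_le_cmod[of z] z1 by linarith
    then have "\<bar>real_of_int d\<bar> \<le> 1 + \<bar>real_of_int c * Re \<tau>\<bar>" by (simp add: z_def)
    also have "\<bar>real_of_int c * Re \<tau>\<bar> \<le> M * \<bar>Re \<tau>\<bar>"
      unfolding abs_mult using c by (intro mult_right_mono) linarith+
    finally have "\<bar>d\<bar> \<le> N" unfolding N_def by linarith
    with c r show "r \<in> h ` ({-M..M} \<times> {-N..N})" by (intro image_eqI[of _ _ "(c, d)"]) auto
  qed
  then show ?thesis by (rule finite_subset) simp
qed

text \<open>
  This region contains the classical domain \<open>\<bar>Re \<tau>\<bar> \<le> 1/2\<close>, \<open>\<bar>\<tau>\<bar> \<ge> 1\<close>. In the coordinates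
  \<open>(Re \<tau>, \<bar>\<tau>\<bar>\<^sup>2)\<close> it is the part of a vertical strip above the parabola \<open>\<bar>\<tau>\<bar>\<^sup>2 = (Re \<tau>)\<^sup>2 + 3/4\<close>, a
  convex set.
\<close>

definition reduced_region :: "complex set"
  where "reduced_region = {\<tau>. \<bar>Re \<tau>\<bar> \<le> 1 / 2 \<and> Im \<tau> > 0 \<and> (Im \<tau>)\<^sup>2 \<ge> 3 / 4}"

text \<open>
  Take a point of the orbit with maximal imaginary part and translate it into the strip. If it had
  absolute value less than 1, then \<open>w \<mapsto> -1/w\<close> would increase its imaginary part.
\<close>

lemma orbit_meets_reduced_region:
  assumes "\<tau> \<in> \<H>"
  shows "\<exists>\<gamma>\<in>SL2Z. mob \<gamma> \<tau> \<in> reduced_region"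
proof -
  define V where "V = {Im (mob \<gamma> \<tau>) |\<gamma>. \<gamma> \<in> SL2Z \<and> Im (mob \<gamma> \<tau>) \<ge> Im \<tau>}"
  have fin: "finite V" unfolding V_def by (rule finite_Im_ge_in_orbit[OF assms])
  have "Im \<tau> \<in> V"
    using SL2Z_orbit_refl[of \<tau>] unfolding V_def SL2Z_orbit_def by force
  then have "Max V \<in> V" "Im \<tau> \<le> Max V" using fin by (auto intro: Max_in)
  then obtain \<gamma> where \<gamma>: "\<gamma> \<in> SL2Z" "Im (mob \<gamma> \<tau>) = Max V" by (auto simp: V_def)
  have max: "Im (mob \<delta> \<tau>) \<le> Max V" if "\<delta> \<in> SL2Z" for \<delta>
  proof (cases "Im (mob \<delta> \<tau>) \<ge> Im \<tau>")
    case True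
    then show ?thesis using that fin by (intro Max_ge) (auto simp: V_def)
  qed (use \<open>Im \<tau> \<le> Max V\<close> in simp)
  define n where "n = round (Re (mob \<gamma> \<tau>))"
  define T where "T = matrix2 1 (-n) 0 1"
  define S where "S = matrix2 0 (-1) 1 0"
  have TS: "T \<in> SL2Z" "S \<in> SL2Z" by (simp_all add: T_def S_def)
  have T: "mob T z = z - of_int n" for z by (simp add: mob_def T_def)
  define w where "w = mob (T ** \<gamma>) \<tau>"
  have w: "w = mob \<gamma> \<tau> - of_int n"
    by (simp add: w_def mob_mult[OF \<gamma>(1) assms] T)
  have wH: "w \<in> \<H>" using SL2Z_mult[OF TS(1) \<gamma>(1)] assms mob_in_upper_half_plane w_def by blast
  have Re: "\<bar>Re w\<bar> \<le> 1 / 2"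
    using of_int_round_abs_le[of "Re (mob \<gamma> \<tau>)"] by (simp add: w n_def abs_minus_commute)
  have "cmod w \<ge> 1"
  proof (rule ccontr)
    assume "\<not> cmod w \<ge> 1"
    moreover have "w \<noteq> 0" using wH by auto
    ultimately have less: "0 < (cmod w)\<^sup>2" "(cmod w)\<^sup>2 < 1"
      by (auto simp: power_less_one_iff abs_square_less_1)
    have "Im (mob (S ** (T ** \<gamma>)) \<tau>) = Im w / (cmod w)\<^sup>2"
      using mob_mult[OF SL2Z_mult[OF TS(1) \<gamma>(1)] assms, of S]
      by (simp add: w_def[symmetric] Im_mob[OF TS(2)]) (simp add: S_def)
    also have "\<dots> > Im w" using less wH by (simp add: field_simps)
    also have "Im w = Max V" using \<gamma> w by simp
    finally show False using max[OF SL2Z_mult[OF TS(2) SL2Z_mult[OF TS(1) \<gamma>(1)]]] by simp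
  qed
  then have "1 \<le> (cmod w)\<^sup>2" by simp
  moreover have "(Re w)\<^sup>2 \<le> (1/2)\<^sup>2" using Re by (metis abs_le_square_iff abs_of_nonneg zero_le_divide_1_iff zero_le_numeral)
  ultimately have "(Im w)\<^sup>2 \<ge> 3 / 4" unfolding cmod_power2 by (simp add: power_divide)
  then show ?thesis using Re wH SL2Z_mult[OF TS(1) \<gamma>(1)] by (auto simp: reduced_region_def w_def)
qed

section \<open>The exceptional set\<close>

text \<open>
  The group acts on quadratic forms by substitution, and this preserves the discriminant. The
  coefficients \<open>a'\<close>, \<open>b'\<close>, \<open>c'\<close> in the proof are those of the form composed with \<open>\<gamma>\<inverse>\<close>.
\<close>

lemma mob_exceptional_set:
  assumes "\<gamma> \<in> SL2Z" "\<tau> \<in> exceptional_set D"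
  shows "mob \<gamma> \<tau> \<in> exceptional_set D"
proof -
  obtain a b c where Q: "b\<^sup>2 - 4 * a * c = D" "\<tau> \<in> \<H>"
    and zero: "of_int a * (cmod \<tau>)\<^sup>2 + of_int b * Re \<tau> + of_int c = 0"
    using assms(2) by (auto simp: exceptional_set_def quadratic_forms_def geodesic_def)
  define p q r s where "p = \<gamma>$1$1" "q = \<gamma>$1$2" "r = \<gamma>$2$1" "s = \<gamma>$2$2"
  have det: "p * s - q * r = 1" using assms(1) by (simp add: mem_SL2Z p_q_r_s_def)
  define u v :: complex where "u = of_int p * \<tau> + of_int q" "v = of_int r * \<tau> + of_int s"
  have v: "v \<noteq> 0" using mob_denominator_nonzero[OF assms(1) Q(2)] by (simp add: u_v_def p_q_r_s_def)
  define a' b' c' where "a' = a * s\<^sup>2 - b * r * s + c * r\<^sup>2"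
    "b' = - 2 * a * q * s + b * (p * s + q * r) - 2 * c * p * r"
    "c' = a * q\<^sup>2 - b * p * q + c * p\<^sup>2"
  have "b'\<^sup>2 - 4 * a' * c' = (b\<^sup>2 - 4 * a * c) * (p * s - q * r)\<^sup>2"
    unfolding a'_b'_c'_def by algebra
  then have disc: "b'\<^sup>2 - 4 * a' * c' = D" using det Q by simp
  have "of_int a' * (cmod u)\<^sup>2 + of_int b' * Re (u * cnj v) + of_int c' * (cmod v)\<^sup>2
      = of_int ((p * s - q * r)\<^sup>2) * (of_int a * (cmod \<tau>)\<^sup>2 + of_int b * Re \<tau> + of_int c)"
    unfolding cmod_power2 by (simp add: u_v_def a'_b'_c'_def) algebra
  then have *: "of_int a' * (cmod u)\<^sup>2 + of_int b' * Re (u * cnj v) + of_int c' * (cmod v)\<^sup>2 = 0"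
    using zero by simp
  have m: "mob \<gamma> \<tau> = u / v" by (simp add: mob_def u_v_def p_q_r_s_def)
  have "Re (u / v) = Re (u * cnj v) / (cmod v)\<^sup>2"
    by (subst complex_div_cnj) (simp only: of_real_power[symmetric] Re_divide_of_real)
  then have "of_int a' * (cmod (mob \<gamma> \<tau>))\<^sup>2 + of_int b' * Re (mob \<gamma> \<tau>) + of_int c'
      = (of_int a' * (cmod u)\<^sup>2 + of_int b' * Re (u * cnj v) + of_int c' * (cmod v)\<^sup>2) / (cmod v)\<^sup>2"
    using v by (simp add: m norm_divide power_divide field_simps)
  also have "\<dots> = 0" using * by simp
  finally have "mob \<gamma> \<tau> \<in> geodesic (a', b', c')"
    using mob_in_upper_half_plane[OF assms(1) Q(2)] by (simp add: geodesic_def)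
  then show ?thesis using disc by (auto simp: exceptional_set_def quadratic_forms_def)
qed

text \<open>
  At a point \<open>x + \<i>y\<close> of the geodesic of \<open>[a, b, c]\<close>, eliminating \<open>c\<close> turns the discriminant into
  \<open>D = (2ax + b)\<^sup>2 + (2ay)\<^sup>2\<close>. A positive lower bound on \<open>y\<close> thus bounds \<open>a\<close>, and a bound on \<open>x\<close> then
  bounds \<open>b\<close>. The coefficient \<open>c\<close> is bounded by \<open>4ac = b\<^sup>2 - D\<close> for \<open>a \<noteq> 0\<close> and by \<open>c = -bx\<close> for
  \<open>a = 0\<close>, and all these bounds hold uniformly as \<open>y\<close> grows.
\<close>

lemma finite_forms_meeting_half_strip:
  assumes "m > 0"
  shows "finite {Q \<in> quadratic_forms D. geodesic Q \<inter> {\<tau>. \<bar>Re \<tau>\<bar> \<le> M \<and> Im \<tau> \<ge> m} \<noteq> {}}"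
    (is "finite ?A")
proof -
  define d where "d = sqrt D"
  \<comment> \<open>\<open>A\<close>, \<open>B\<close> and \<open>N\<close> bound \<open>\<bar>a\<bar>\<close>, \<open>\<bar>b\<bar>\<close> and \<open>\<bar>c\<bar>\<close>.\<close>
  define A where "A = \<lceil>d / (2 * m)\<rceil>"
  define B where "B = \<lceil>d + 2 * A * M\<rceil>"
  define N where "N = max (B\<^sup>2 + \<bar>D\<bar>) \<lceil>B * M\<rceil>"
  have "?A \<subseteq> {-A..A} \<times> {-B..B} \<times> {-N..N}"
  proof
    fix Q assume "Q \<in> ?A"
    then obtain a b c \<tau> where Q: "Q = (a, b, c)" and disc: "b\<^sup>2 - 4 * a * c = D"
      and zero: "of_int a * (cmod \<tau>)\<^sup>2 + of_int b * Re \<tau> + of_int c = 0"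
      and \<tau>: "\<bar>Re \<tau>\<bar> \<le> M" "Im \<tau> \<ge> m"
      by (auto simp: quadratic_forms_def geodesic_def)
    define x y where "x = Re \<tau>" "y = Im \<tau>"
    have c: "real_of_int c = - (a * (x\<^sup>2 + y\<^sup>2) + b * x)"
      using zero by (simp add: cmod_power2 x_y_def)
    have "real_of_int D = b\<^sup>2 - 4 * a * real_of_int c"
      unfolding disc[symmetric] by simp
    then have D: "real_of_int D = (2 * a * x + b)\<^sup>2 + (2 * a * y)\<^sup>2"
      unfolding c by (simp add: power2_eq_square algebra_simps)
    have "sqrt ((2 * a * y)\<^sup>2) \<le> d" "sqrt ((2 * a * x + b)\<^sup>2) \<le> d"
      unfolding d_def D by (intro real_sqrt_le_mono; simp)+
    then have ay: "\<bar>2 * a * y\<bar> \<le> d" and axb: "\<bar>2 * a * x + b\<bar> \<le> d"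
      unfolding real_sqrt_abs by blast+
    have "\<bar>real_of_int a\<bar> * (2 * m) \<le> \<bar>real_of_int a\<bar> * (2 * y)"
      using \<tau> by (intro mult_left_mono) (auto simp: x_y_def)
    also have "\<dots> = \<bar>2 * a * y\<bar>" using \<tau> assms by (simp add: abs_mult x_y_def)
    finally have "\<bar>real_of_int a\<bar> \<le> d / (2 * m)" using ay assms by (simp add: field_simps)
    then have a: "\<bar>a\<bar> \<le> A" unfolding A_def by linarith
    have "\<bar>a * x\<bar> \<le> A * M"
      unfolding abs_mult using a \<tau> by (intro mult_mono) (auto simp: x_y_def)
    then have b: "\<bar>b\<bar> \<le> B" using axb unfolding B_def by linarith
    have "\<bar>c\<bar> \<le> N"
    proof (cases "a = 0")
      case True
      then have "\<bar>real_of_int c\<bar> = \<bar>b * x\<bar>" using c by simp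
      also have "\<dots> \<le> B * M"
        unfolding abs_mult using b \<tau> by (intro mult_mono) (auto simp: x_y_def)
      finally show ?thesis unfolding N_def by linarith
    next
      case False
      have "\<bar>c\<bar> \<le> \<bar>4 * a\<bar> * \<bar>c\<bar>" using False by (intro mult_le_cancel_right1[THEN iffD2]) auto
      also have "\<dots> = \<bar>b\<^sup>2 - D\<bar>" using disc by (simp add: abs_mult[symmetric])
      also have "\<dots> \<le> \<bar>b\<bar>\<^sup>2 + \<bar>D\<bar>" using abs_triangle_ineq4[of "b\<^sup>2" D] by simp
      also have "\<bar>b\<bar>\<^sup>2 \<le> B\<^sup>2" using b by (intro power_mono) auto
      finally show ?thesis unfolding N_def by simp
    qed
    with a b Q show "Q \<in> {-A..A} \<times> {-B..B} \<times> {-N..N}" by auto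
  qed
  then show ?thesis by (rule finite_subset) simp
qed

text \<open>Geodesics are closed in \<open>\<H>\<close>, and by the preceding lemma they form a locally finite family.\<close>

lemma open_complement_exceptional_set: "open (\<H> - exceptional_set D)"
proof (rule openI)
  fix \<tau> assume \<tau>: "\<tau> \<in> \<H> - exceptional_set D"
  \<comment> \<open>The half strip \<open>K\<close> bounded by \<open>M\<close> and \<open>m\<close> is a neighbourhood of \<open>\<tau>\<close>.\<close>
  define M where "M = \<bar>Re \<tau>\<bar> + 1"
  define m where "m = Im \<tau> / 2"
  have m: "m > 0" using \<tau> by (simp add: m_def)
  define A where "A = {Q \<in> quadratic_forms D. geodesic Q \<inter> {\<tau>. \<bar>Re \<tau>\<bar> \<le> M \<and> Im \<tau> \<ge> m} \<noteq> {}}"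
  define K where "K = {z. \<bar>Re z\<bar> < M} \<inter> {z. Im z > m}"
  define Z where "Z = (\<lambda>(a::int, b::int, c::int). {z. of_int a * (cmod z)\<^sup>2 + of_int b * Re z + of_int c = 0})"
  have "open K" unfolding K_def
    by (intro open_Int open_halfspace_Im_gt open_Collect_less continuous_intros)
  moreover have "closed (\<Union>Q\<in>A. Z Q)"
    using finite_forms_meeting_half_strip[OF m] unfolding A_def
    by (intro closed_UN) (auto simp: Z_def intro!: closed_Collect_eq continuous_intros)
  ultimately have "open (K - (\<Union>Q\<in>A. Z Q))" by (rule open_Diff)
  moreover have KH: "K \<subseteq> \<H>" using m by (auto simp: K_def)
  have "K - (\<Union>Q\<in>A. Z Q) = K - exceptional_set D"
  proof -
    have "z \<in> exceptional_set D \<longleftrightarrow> z \<in> (\<Union>Q\<in>A. Z Q)" if z: "z \<in> K" for z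
    proof -
      have "z \<in> geodesic Q \<longleftrightarrow> z \<in> Z Q" for Q
        using KH z by (cases Q) (auto simp: geodesic_def Z_def)
      moreover have "Q \<in> A" if "Q \<in> quadratic_forms D" "z \<in> geodesic Q" for Q
        using that z unfolding A_def K_def by fastforce
      ultimately show ?thesis unfolding exceptional_set_def A_def by blast
    qed
    then show ?thesis by blast
  qed
  ultimately have "open (K - exceptional_set D)" by simp
  moreover have "\<tau> \<in> K - exceptional_set D" using \<tau> by (simp add: K_def M_def m_def)
  ultimately show "\<exists>e>0. ball \<tau> e \<subseteq> \<H> - exceptional_set D"
    using KH by (meson Diff_mono open_contains_ball order_refl order_trans)
qed


section \<open>Chambers\<close>

definition chambers :: "int \<Rightarrow> complex set set"
  where "chambers D = components (\<H> - exceptional_set D)"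

lemma chamber_nonempty: "C \<in> chambers D \<Longrightarrow> C \<noteq> {}"
  unfolding chambers_def by (rule in_components_nonempty)

lemma chamber_subset: "C \<in> chambers D \<Longrightarrow> C \<subseteq> \<H> - exceptional_set D"
  unfolding chambers_def by (rule in_components_subset)

lemma open_chamber: "C \<in> chambers D \<Longrightarrow> open C"
  unfolding chambers_def using open_components open_complement_exceptional_set by blast

lemma chambers_disjoint:
  "C \<in> chambers D \<Longrightarrow> C' \<in> chambers D \<Longrightarrow> \<tau> \<in> C \<Longrightarrow> \<tau> \<in> C' \<Longrightarrow> C = C'"
  unfolding chambers_def using components_nonoverlap by fastforce

lemma in_some_chamber: "\<tau> \<in> \<H> - exceptional_set D \<Longrightarrow> \<exists>C\<in>chambers D. \<tau> \<in> C"
  unfolding chambers_def using Union_components[of "\<H> - exceptional_set D"] by blast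

lemma mob_image_complement:
  assumes "\<gamma> \<in> SL2Z" "\<tau> \<in> \<H> - exceptional_set D"
  shows "mob \<gamma> \<tau> \<in> \<H> - exceptional_set D"
proof -
  have "mob \<gamma> \<tau> \<notin> exceptional_set D"
    using mob_exceptional_set[OF SL2Z_inverse_in_SL2Z[OF assms(1)], of "mob \<gamma> \<tau>"] assms
    by (auto simp: mob_inverse_left)
  then show ?thesis using mob_in_upper_half_plane assms by blast
qed

lemma mob_image_inverse_left:
  "\<gamma> \<in> SL2Z \<Longrightarrow> C \<subseteq> \<H> \<Longrightarrow> mob (SL2Z_inverse \<gamma>) ` mob \<gamma> ` C = C"
  by (force simp: image_image mob_inverse_left subset_iff)

lemma mob_image_inverse_right:
  "\<gamma> \<in> SL2Z \<Longrightarrow> C \<subseteq> \<H> \<Longrightarrow> mob \<gamma> ` mob (SL2Z_inverse \<gamma>) ` C = C"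
  using mob_image_inverse_left[of "SL2Z_inverse \<gamma>" C] by (simp add: SL2Z_inverse_in_SL2Z)

lemma connected_mob_image:
  assumes "\<gamma> \<in> SL2Z" "C \<subseteq> \<H>" "connected C"
  shows "connected (mob \<gamma> ` C)"
  using assms isCont_mob by (intro connected_continuous_image continuous_at_imp_continuous_on) blast+

lemma mob_image_chamber:
  assumes \<gamma>: "\<gamma> \<in> SL2Z" and C: "C \<in> chambers D"
  shows "mob \<gamma> ` C \<in> chambers D"
proof -
  let ?S = "\<H> - exceptional_set D"
  have CH: "C \<subseteq> \<H>" using chamber_subset[OF C] by blast
  have max: "d = mob \<gamma> ` C"
    if d: "d \<noteq> {}" "mob \<gamma> ` C \<subseteq> d" "d \<subseteq> ?S" "connected d" for d
  proof -
    let ?d = "mob (SL2Z_inverse \<gamma>) ` d"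
    have "C \<subseteq> ?d" using mob_image_inverse_left[OF \<gamma> CH] d(2) by blast
    moreover have "?d \<subseteq> ?S" using mob_image_complement[OF SL2Z_inverse_in_SL2Z[OF \<gamma>]] d(3) by blast
    moreover have "connected ?d"
      using d(3,4) by (intro connected_mob_image SL2Z_inverse_in_SL2Z \<gamma>) auto
    moreover have "C \<inter> ?d \<noteq> {}" using \<open>C \<subseteq> ?d\<close> chamber_nonempty[OF C] by auto
    ultimately have "?d \<subseteq> C"
      using C components_maximal unfolding chambers_def by metis
    moreover have "mob \<gamma> ` ?d = d" using d(3) by (intro mob_image_inverse_right[OF \<gamma>]) auto
    ultimately show ?thesis using d(2) image_mono[of ?d C "mob \<gamma>"] by simp
  qed
  have "mob \<gamma> ` C \<subseteq> ?S" using mob_image_complement[OF \<gamma>] chamber_subset[OF C] by blast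
  moreover have "connected (mob \<gamma> ` C)"
    using C CH in_components_connected unfolding chambers_def by (intro connected_mob_image[OF \<gamma>])
  ultimately show ?thesis
    using chamber_nonempty[OF C] unfolding chambers_def in_components_maximal
    by (intro conjI allI impI max) auto
qed

lemma closure_mob_image:
  assumes "\<gamma> \<in> SL2Z" "\<tau> \<in> \<H>" "\<tau> \<in> closure C"
  shows "mob \<gamma> \<tau> \<in> closure (mob \<gamma> ` C)"
proof -
  obtain x where x: "\<And>n. x n \<in> C" "x \<longlonglongrightarrow> \<tau>" using assms(3) unfolding closure_sequential by blast
  have "(\<lambda>n. mob \<gamma> (x n)) \<longlonglongrightarrow> mob \<gamma> \<tau>"
    using isCont_mob[OF assms(1,2)] x(2) by (rule isCont_tendsto_compose)
  moreover have "\<forall>n. mob \<gamma> (x n) \<in> mob \<gamma> ` C" using x(1) by simp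
  ultimately show ?thesis unfolding closure_sequential by (intro exI[of _ "\<lambda>n. mob \<gamma> (x n)"] conjI)
qed

section \<open>Orbits of chambers\<close>

definition chamber_orbit :: "complex set \<Rightarrow> complex set set"
  where "chamber_orbit C = {mob \<gamma> ` C |\<gamma>. \<gamma> \<in> SL2Z}"

definition chamber_orbits :: "int \<Rightarrow> complex set set set"
  where "chamber_orbits D = chamber_orbit ` chambers D"

lemma chamber_orbit_subset: "C \<in> chambers D \<Longrightarrow> chamber_orbit C \<subseteq> chambers D"
  by (auto simp: chamber_orbit_def mob_image_chamber)

lemma chamber_orbit_refl: "C \<in> chamber_orbit C"
proof -
  have "mob (matrix2 1 0 0 1) ` C = C" by (simp add: mob_def)
  then show ?thesis unfolding chamber_orbit_def by (auto intro!: exI[of _ "matrix2 1 0 0 1"])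
qed

lemma chamber_orbit_mob_image:
  assumes \<gamma>: "\<gamma> \<in> SL2Z" and C: "C \<in> chambers D"
  shows "chamber_orbit (mob \<gamma> ` C) = chamber_orbit C"
proof -
  have sub: "chamber_orbit (mob \<gamma> ` C) \<subseteq> chamber_orbit C" if "\<gamma> \<in> SL2Z" "C \<subseteq> \<H>" for \<gamma> C
  proof
    fix B assume "B \<in> chamber_orbit (mob \<gamma> ` C)"
    then obtain \<delta> where \<delta>: "\<delta> \<in> SL2Z" "B = mob \<delta> ` mob \<gamma> ` C" by (auto simp: chamber_orbit_def)
    have "mob (\<delta> ** \<gamma>) ` C = B"
      unfolding \<delta>(2) image_image using that by (intro image_cong refl mob_mult) auto
    then show "B \<in> chamber_orbit C"
      using SL2Z_mult[OF \<delta>(1) that(1)] unfolding chamber_orbit_def by blast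
  qed
  have CH: "C \<subseteq> \<H>" "mob \<gamma> ` C \<subseteq> \<H>" using chamber_subset[of _ D] C mob_image_chamber[OF \<gamma> C] by blast+
  show ?thesis
    using sub[OF \<gamma> CH(1)] sub[OF SL2Z_inverse_in_SL2Z[OF \<gamma>] CH(2)] mob_image_inverse_left[OF \<gamma> CH(1)]
    by auto
qed

lemma mem_chamber_orbits_iff:
  assumes "\<omega> \<in> chamber_orbits D" "C \<in> chambers D"
  shows "C \<in> \<omega> \<longleftrightarrow> chamber_orbit C = \<omega>"
proof -
  obtain B where B: "B \<in> chambers D" "\<omega> = chamber_orbit B"
    using assms(1) by (auto simp: chamber_orbits_def)
  show ?thesis
    using chamber_orbit_mob_image[OF _ B(1)] chamber_orbit_refl[of C]
    unfolding B(2) by (auto simp: chamber_orbit_def[of B])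
qed

text \<open>
  Two points of the region on the same side of each of the finitely many geodesics that meet it are
  joined by a path in the region that avoids \<open>E\<^sub>D\<close>: the segment between them in the coordinates
  \<open>(Re \<tau>, \<bar>\<tau>\<bar>\<^sup>2)\<close>, in which the equation of a geodesic is affine. So the set of forms that are positive
  at a point of a chamber in the region determines the chamber.
\<close>

lemma finite_chambers_meeting_reduced_region:
  "finite {C \<in> chambers D. C \<inter> reduced_region \<noteq> {}}" (is "finite ?X")
proof -
  let ?E = "exceptional_set D"
  define A where "A = {Q \<in> quadratic_forms D. geodesic Q \<inter> {\<tau>. \<bar>Re \<tau>\<bar> \<le> 1/2 \<and> Im \<tau> \<ge> 1/2} \<noteq> {}}"
  have finA: "finite A" unfolding A_def by (rule finite_forms_meeting_half_strip) simp
  define val :: "int \<times> int \<times> int \<Rightarrow> complex \<Rightarrow> real"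
    where "val = (\<lambda>(a, b, c) \<tau>. of_int a * (cmod \<tau>)\<^sup>2 + of_int b * Re \<tau> + of_int c)"
  define pos where "pos \<tau> = {Q \<in> A. val Q \<tau> > 0}" for \<tau>
  have A: "Q \<in> A" if "Q \<in> quadratic_forms D" "\<tau> \<in> geodesic Q" "\<tau> \<in> reduced_region" for Q \<tau>
  proof -
    have "(1/2)\<^sup>2 \<le> (Im \<tau>)\<^sup>2" using that(3) by (simp add: reduced_region_def power2_eq_square)
    moreover have "0 \<le> Im \<tau>" using that(3) by (simp add: reduced_region_def)
    ultimately have "1/2 \<le> Im \<tau>" by (rule power2_le_imp_le)
    then show ?thesis using that by (auto simp: A_def reduced_region_def)
  qed
  have geod: "\<tau> \<in> geodesic Q \<longleftrightarrow> val Q \<tau> = 0" if "\<tau> \<in> \<H>" for \<tau> Q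
    using that by (cases Q) (simp add: geodesic_def val_def)
  \<comment> \<open>\<open>(x t, n t)\<close> runs through the segment, and \<open>h t\<close> is the point with these coordinates.\<close>
  have join: "connected_component (\<H> - ?E) \<tau> \<tau>'"
    if \<tau>: "\<tau> \<in> reduced_region - ?E" "\<tau>' \<in> reduced_region - ?E" and eq: "pos \<tau> = pos \<tau>'" for \<tau> \<tau>'
  proof -
    define x n where "x t = (1 - t) * Re \<tau> + t * Re \<tau>'"
      "n t = (1 - t) * (cmod \<tau>)\<^sup>2 + t * (cmod \<tau>')\<^sup>2" for t
    define h where "h t = Complex (x t) (sqrt (n t - (x t)\<^sup>2))" for t
    have ends: "h 0 = \<tau>" "h 1 = \<tau>'"
      using \<tau> by (auto simp: h_def x_n_def cmod_power2 reduced_region_def complex_eq_iff)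
    have h: "h t \<in> reduced_region - ?E" if t: "t \<in> {0..1}" for t
    proof -
      have "n t - (x t)\<^sup>2 = (1 - t) * (Im \<tau>)\<^sup>2 + t * (Im \<tau>')\<^sup>2 + t * (1 - t) * (Re \<tau> - Re \<tau>')\<^sup>2"
        unfolding x_n_def cmod_power2 by algebra
      also have "\<dots> \<ge> (1 - t) * (3/4) + t * (3/4) + 0"
        using \<tau> t by (intro add_mono mult_left_mono) (auto simp: reduced_region_def)
      finally have n: "n t - (x t)\<^sup>2 \<ge> 3/4" by (simp add: field_simps)
      have "\<bar>x t\<bar> \<le> (1 - t) * \<bar>Re \<tau>\<bar> + t * \<bar>Re \<tau>'\<bar>"
        unfolding x_n_def using t abs_triangle_ineq[of "(1 - t) * Re \<tau>" "t * Re \<tau>'"] by (simp add: abs_mult)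
      also have "\<dots> \<le> (1 - t) * (1/2) + t * (1/2)"
        using \<tau> t by (intro add_mono mult_left_mono) (auto simp: reduced_region_def)
      finally have "\<bar>x t\<bar> \<le> 1/2" by (simp add: field_simps)
      then have red: "h t \<in> reduced_region" using n by (simp add: h_def reduced_region_def)
      then have hH: "h t \<in> \<H>" by (simp add: reduced_region_def)
      have Re_h: "Re (h t) = x t" by (simp add: h_def)
      have "(cmod (h t))\<^sup>2 = n t" using n by (simp add: h_def cmod_power2)
      then have lin: "val Q (h t) = (1 - t) * val Q \<tau> + t * val Q \<tau>'" for Q
        by (cases Q) (simp add: val_def Re_h, simp add: x_n_def algebra_simps)
      have "h t \<notin> ?E"
      proof
        assume "h t \<in> ?E"
        then obtain Q where Q: "Q \<in> quadratic_forms D" "h t \<in> geodesic Q" by (auto simp: exceptional_set_def)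
        have QA: "Q \<in> A" using A[OF Q red] .
        have nz: "val Q \<tau> \<noteq> 0" "val Q \<tau>' \<noteq> 0"
          using \<tau> Q(1) geod[of _ Q] by (auto simp: exceptional_set_def reduced_region_def)
        have iff: "val Q \<tau> > 0 \<longleftrightarrow> val Q \<tau>' > 0" using eq QA by (auto simp: pos_def)
        have zero: "(1 - t) * val Q \<tau> + t * val Q \<tau>' = 0" using Q(2) geod[OF hH] lin by simp
        show False
        proof (cases "val Q \<tau> > 0")
          case True
          then have "(1 - t) * val Q \<tau> + t * val Q \<tau>' > 0"
            using iff t by (cases "t = 0") (auto intro: add_nonneg_pos)
          then show False using zero by simp
        next
          case False
          then have "val Q \<tau> < 0" "val Q \<tau>' < 0" using nz iff by auto
          then have "(1 - t) * val Q \<tau> + t * val Q \<tau>' < 0"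
            using t by (cases "t = 0") (auto intro!: add_nonpos_neg mult_nonneg_nonpos mult_pos_neg)
          then show False using zero by simp
        qed
      qed
      then show ?thesis using red by blast
    qed
    have "continuous_on {0..1} h"
      unfolding h_def x_n_def Complex_eq by (intro continuous_intros)
    then have "connected (h ` {0..1})" by (intro connected_continuous_image) auto
    moreover have "h ` {0..1} \<subseteq> \<H> - ?E" using h by (auto simp: reduced_region_def)
    moreover have "\<tau> \<in> h ` {0..1}" "\<tau>' \<in> h ` {0..1}" using ends by force+
    ultimately show ?thesis unfolding connected_component_def by blast
  qed
  define p where "p C = (SOME \<tau>. \<tau> \<in> C \<inter> reduced_region)" for C
  have p: "p C \<in> C \<inter> reduced_region" if "C \<in> ?X" for C
    using that unfolding p_def some_in_eq by blast
  have "inj_on (pos \<circ> p) ?X"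
  proof (rule inj_onI)
    fix B C assume BC: "B \<in> ?X" "C \<in> ?X" "(pos \<circ> p) B = (pos \<circ> p) C"
    have "connected_component (\<H> - ?E) (p B) (p C)"
      using BC p chamber_subset[of _ D] by (intro join) auto
    then obtain K where K: "connected K" "K \<subseteq> \<H> - ?E" "p B \<in> K" "p C \<in> K"
      by (auto simp: connected_component_def)
    have "B \<inter> K \<noteq> {}" using p[OF BC(1)] K(3) by blast
    then have "K \<subseteq> B" using components_maximal BC(1) K(1,2) unfolding chambers_def by blast
    then show "B = C" using chambers_disjoint[of B D C "p C"] BC(1,2) p[OF BC(2)] K(4) by blast
  qed
  moreover have "(pos \<circ> p) ` ?X \<subseteq> Pow A" by (auto simp: pos_def)
  ultimately show ?thesis using finA by (meson finite_Pow_iff finite_imageD finite_subset)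
qed

lemma finite_chamber_orbits: "finite (chamber_orbits D)"
proof -
  have "chamber_orbits D \<subseteq> chamber_orbit ` {C \<in> chambers D. C \<inter> reduced_region \<noteq> {}}"
  proof
    fix \<omega> assume "\<omega> \<in> chamber_orbits D"
    then obtain C where C: "C \<in> chambers D" "\<omega> = chamber_orbit C" by (auto simp: chamber_orbits_def)
    obtain \<tau> where \<tau>: "\<tau> \<in> C" using chamber_nonempty[OF C(1)] by blast
    then have "\<tau> \<in> \<H>" using chamber_subset[OF C(1)] by blast
    then obtain \<gamma> where \<gamma>: "\<gamma> \<in> SL2Z" "mob \<gamma> \<tau> \<in> reduced_region" using orbit_meets_reduced_region by blast
    then have "mob \<gamma> ` C \<in> {C \<in> chambers D. C \<inter> reduced_region \<noteq> {}}"
      using mob_image_chamber[OF _ C(1)] \<tau> by blast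
    moreover have "\<omega> = chamber_orbit (mob \<gamma> ` C)" using chamber_orbit_mob_image[OF \<gamma>(1) C(1)] C(2) by simp
    ultimately show "\<omega> \<in> chamber_orbit ` {C \<in> chambers D. C \<inter> reduced_region \<noteq> {}}" by blast
  qed
  then show ?thesis by (rule finite_subset) (simp add: finite_chambers_meeting_reduced_region)
qed

section \<open>Fundamental domains\<close>

lemma components_meeting_eq: "components_meeting D F = {C \<in> chambers D. C \<inter> F \<noteq> {}}"
  by (simp add: components_meeting_def chambers_def)

lemma num_components_ge:
  assumes "fundamental_domain F"
  shows "enat (card (chamber_orbits D)) \<le> num_components D F"
proof (cases "finite (components_meeting D F)")
  case True
  have "chamber_orbits D \<subseteq> chamber_orbit ` components_meeting D F"
  proof
    fix \<omega> assume "\<omega> \<in> chamber_orbits D"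
    then obtain C where C: "C \<in> chambers D" "\<omega> = chamber_orbit C" by (auto simp: chamber_orbits_def)
    obtain \<tau> where \<tau>: "\<tau> \<in> C" using chamber_nonempty[OF C(1)] by blast
    then have "\<tau> \<in> \<H>" using chamber_subset[OF C(1)] by blast
    then obtain w where "w \<in> F" "w \<in> SL2Z_orbit \<tau>"
      using assms unfolding fundamental_domain_def by blast
    then obtain \<gamma> where \<gamma>: "\<gamma> \<in> SL2Z" "mob \<gamma> \<tau> \<in> F" by (auto simp: SL2Z_orbit_def)
    then have "mob \<gamma> ` C \<in> components_meeting D F"
      using mob_image_chamber[OF _ C(1)] \<tau> by (auto simp: components_meeting_eq)
    moreover have "\<omega> = chamber_orbit (mob \<gamma> ` C)" using chamber_orbit_mob_image[OF \<gamma>(1) C(1)] C(2) by simp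
    ultimately show "\<omega> \<in> chamber_orbit ` components_meeting D F" by blast
  qed
  then have "card (chamber_orbits D) \<le> card (components_meeting D F)"
    using True by (rule surj_card_le[rotated])
  then show ?thesis using True by (simp add: num_components_def)
qed (simp add: num_components_def)

text \<open>
  Points of \<open>E\<^sub>D\<close> lie in no chamber, so their orbits may be represented arbitrarily; any other orbit
  has a point in one of the chosen chambers \<open>T\<close>.
\<close>

lemma ex_fundamental_domain_num_components_le:
  "\<exists>F. fundamental_domain F \<and> num_components D F \<le> enat (card (chamber_orbits D))"
proof -
  let ?E = "exceptional_set D"
  define rep where "rep \<omega> = (SOME C. C \<in> \<omega>)" for \<omega> :: "complex set set"
  define T where "T = rep ` chamber_orbits D"
  have rep: "rep \<omega> \<in> \<omega>" if "\<omega> \<in> chamber_orbits D" for \<omega>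
    using that chamber_orbit_refl unfolding rep_def chamber_orbits_def some_in_eq by blast
  have T: "finite T" "card T \<le> card (chamber_orbits D)" "T \<subseteq> chambers D"
    using finite_chamber_orbits[of D] rep chamber_orbit_subset[of _ D]
    by (auto simp: T_def card_image_le chamber_orbits_def)
  define P where "P \<tau> w \<longleftrightarrow> w \<in> SL2Z_orbit \<tau> \<and> (w \<in> ?E \<or> w \<in> \<Union>T)" for \<tau> w
  define pick where "pick \<tau> = (SOME w. P \<tau> w)" for \<tau>
  have P: "P \<tau> (pick \<tau>)" if \<tau>: "\<tau> \<in> \<H>" for \<tau>
  proof (cases "\<tau> \<in> ?E")
    case True
    then have "P \<tau> \<tau>" by (simp add: P_def SL2Z_orbit_refl)
    then show ?thesis unfolding pick_def by (rule someI)
  next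
    case False
    then obtain C where C: "C \<in> chambers D" "\<tau> \<in> C" using in_some_chamber \<tau> by blast
    then have \<omega>: "chamber_orbit C \<in> chamber_orbits D" by (simp add: chamber_orbits_def)
    obtain \<gamma> where \<gamma>: "\<gamma> \<in> SL2Z" "rep (chamber_orbit C) = mob \<gamma> ` C"
      using rep[OF \<omega>] by (auto simp: chamber_orbit_def)
    then have "P \<tau> (mob \<gamma> \<tau>)"
      using \<omega> C(2) unfolding P_def T_def SL2Z_orbit_def by blast
    then show ?thesis unfolding pick_def by (rule someI)
  qed
  \<comment> \<open>\<open>P \<tau>\<close> depends only on the orbit of \<open>\<tau>\<close>, so equivalent points have the same representative.\<close>
  have pick_cong: "pick \<tau> = pick w" if "\<tau> \<in> \<H>" "w \<in> SL2Z_orbit \<tau>" for \<tau> w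
    using SL2Z_orbit_eq[OF that] by (simp add: pick_def P_def)
  have orbitH: "w \<in> \<H>" if "\<tau> \<in> \<H>" "w \<in> SL2Z_orbit \<tau>" for \<tau> w
    using that mob_in_upper_half_plane by (auto simp: SL2Z_orbit_def)
  define F where "F = pick ` \<H>"
  have "fundamental_domain F"
    unfolding fundamental_domain_def
  proof (intro conjI ballI ex1I)
    show "F \<subseteq> \<H>" using P orbitH unfolding F_def P_def by blast
    fix \<tau> assume \<tau>: "\<tau> \<in> \<H>"
    show "pick \<tau> \<in> F" "pick \<tau> \<in> SL2Z_orbit \<tau>" using \<tau> P unfolding F_def P_def by blast+
    fix w assume w: "w \<in> F \<and> w \<in> SL2Z_orbit \<tau>"
    then obtain z where z: "z \<in> \<H>" "w = pick z" by (auto simp: F_def)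
    have "pick z = pick w" using pick_cong[OF z(1)] P[OF z(1)] z(2) by (simp add: P_def)
    also have "\<dots> = pick \<tau>" using pick_cong[OF \<tau>, of w] w by simp
    finally show "w = pick \<tau>" using z(2) by simp
  qed
  moreover have "components_meeting D F \<subseteq> T"
  proof
    fix C assume "C \<in> components_meeting D F"
    then obtain \<tau> where C: "C \<in> chambers D" and \<tau>: "\<tau> \<in> \<H>" "pick \<tau> \<in> C"
      by (auto simp: components_meeting_eq F_def)
    then have "pick \<tau> \<notin> ?E" using chamber_subset[OF C] by blast
    then obtain C' where "C' \<in> T" "pick \<tau> \<in> C'" using P[OF \<tau>(1)] by (auto simp: P_def)
    then show "C \<in> T" using chambers_disjoint[OF C _ \<tau>(2)] T(3) by blast
  qed
  then have "finite (components_meeting D F)" "card (components_meeting D F) \<le> card T"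
    using T(1) by (auto intro: finite_subset card_mono)
  then have "num_components D F \<le> enat (card (chamber_orbits D))"
    using T(2) by (simp add: num_components_def)
  ultimately show ?thesis by blast
qed

section \<open>Modular local polynomials are locally constant\<close>

text \<open>
  Multiplying the relation by \<open>x\<close> to the power \<open>n = deg q\<close> makes the right-hand side a polynomial of
  degree at most \<open>n\<close>, namely the reflection of \<open>q(-x)\<close>. The left-hand side has degree \<open>n + deg p\<close>
  unless \<open>p = 0\<close>, and the two sides agree at infinitely many points.
\<close>

lemma poly_eq_poly_neg_inverse_imp_degree_0:
  fixes p q :: "'a::field_char_0 poly"
  assumes "infinite S" "0 \<notin> S" "\<And>x. x \<in> S \<Longrightarrow> poly p x = poly q (- 1 / x)"
  shows "degree p = 0"
proof (cases "p = 0")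
  case False
  define r where "r = q \<circ>\<^sub>p [:0, -1:]"
  define s where "s = monom 1 (degree r) * p - reflect_poly r"
  have "S \<subseteq> {x. poly s x = 0}"
  proof
    fix x assume "x \<in> S"
    then have "x \<noteq> 0" "poly p x = poly r (inverse x)"
      using assms by (auto simp: r_def poly_pcompose inverse_eq_divide)
    then show "x \<in> {x. poly s x = 0}"
      by (simp add: s_def poly_monom poly_reflect_poly_nz)
  qed
  then have "s = 0" using assms(1) poly_roots_finite finite_subset by blast
  then have "degree (monom 1 (degree r) * p) \<le> degree r"
    using degree_reflect_poly_le[of r] by (simp add: s_def)
  then show ?thesis using False by (simp add: degree_mult_eq degree_monom_eq)
qed simp

lemma modular_local_polynomial_constant_on_chamber:
  assumes f: "modular_local_polynomial (exceptional_set D) f" and C: "C \<in> chambers D"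
  shows "f constant_on C"
proof -
  define S where "S = matrix2 0 (-1) 1 0"
  have S: "S \<in> SL2Z" by (simp add: S_def)
  have mobS: "mob S \<tau> = - 1 / \<tau>" for \<tau> by (simp add: mob_def S_def)
  obtain p where p: "\<And>\<tau>. \<tau> \<in> C \<Longrightarrow> f \<tau> = poly p \<tau>"
    using f C unfolding modular_local_polynomial_def local_polynomial_def chambers_def by metis
  obtain q where q: "\<And>\<tau>. \<tau> \<in> mob S ` C \<Longrightarrow> f \<tau> = poly q \<tau>"
    using f mob_image_chamber[OF S C]
    unfolding modular_local_polynomial_def local_polynomial_def chambers_def by metis
  have "infinite C"
    using open_chamber[OF C] chamber_nonempty[OF C] finite_imp_not_open by blast
  moreover have "0 \<notin> C" using chamber_subset[OF C] by auto
  moreover have "poly p \<tau> = poly q (- 1 / \<tau>)" if "\<tau> \<in> C" for \<tau>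
  proof -
    have "f (mob S \<tau>) = f \<tau>"
      using f S chamber_subset[OF C] that unfolding modular_local_polynomial_def by blast
    then show ?thesis using p[OF that] q[of "mob S \<tau>"] that by (simp add: mobS)
  qed
  ultimately have "degree p = 0" by (rule poly_eq_poly_neg_inverse_imp_degree_0)
  then obtain k where "p = [:k:]" by (rule degree_eq_zeroE)
  then show ?thesis using p by (auto simp: constant_on_def)
qed

section \<open>Averages over adjacent chambers\<close>

abbreviation adjacent_chambers :: "int \<Rightarrow> complex \<Rightarrow> complex set set"
  where "adjacent_chambers D \<equiv> adjacent_components (exceptional_set D)"

lemma adjacent_chambers_eq: "adjacent_chambers D \<tau> = {C \<in> chambers D. \<tau> \<in> closure C}"
  by (simp add: adjacent_components_def chambers_def closure_Un_frontier)

lemma adjacent_chambers_of_chamber: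
  assumes C: "C \<in> chambers D" and \<tau>: "\<tau> \<in> C"
  shows "adjacent_chambers D \<tau> = {C}"
proof -
  have "B = C" if B: "B \<in> chambers D" "\<tau> \<in> closure B" for B
  proof -
    have "C \<inter> B \<noteq> {}" using open_Int_closure_eq_empty[OF open_chamber[OF C], of B] B(2) \<tau> by blast
    then show ?thesis using chambers_disjoint[OF B(1) C] by blast
  qed
  moreover have "\<tau> \<in> closure C" using \<tau> closure_subset by blast
  ultimately show ?thesis using C unfolding adjacent_chambers_eq by blast
qed

lemma bij_betw_adjacent_chambers:
  assumes \<gamma>: "\<gamma> \<in> SL2Z" and \<tau>: "\<tau> \<in> \<H>"
  shows "bij_betw ((`) (mob \<gamma>)) (adjacent_chambers D \<tau>) (adjacent_chambers D (mob \<gamma> \<tau>))"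
proof (rule bij_betw_byWitness[where f' = "(`) (mob (SL2Z_inverse \<gamma>))"])
  have sub: "(`) (mob \<delta>) ` adjacent_chambers D z \<subseteq> adjacent_chambers D (mob \<delta> z)"
    if "\<delta> \<in> SL2Z" "z \<in> \<H>" for \<delta> z
    using that by (auto simp: adjacent_chambers_eq mob_image_chamber closure_mob_image)
  show "(`) (mob \<gamma>) ` adjacent_chambers D \<tau> \<subseteq> adjacent_chambers D (mob \<gamma> \<tau>)"
    by (rule sub[OF \<gamma> \<tau>])
  show "(`) (mob (SL2Z_inverse \<gamma>)) ` adjacent_chambers D (mob \<gamma> \<tau>) \<subseteq> adjacent_chambers D \<tau>"
    using sub[OF SL2Z_inverse_in_SL2Z[OF \<gamma>] mob_in_upper_half_plane[OF \<gamma> \<tau>]]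
    by (simp add: mob_inverse_left[OF \<gamma> \<tau>])
qed (use chamber_subset[of _ D] \<gamma> in \<open>auto simp: adjacent_chambers_eq
      intro!: mob_image_inverse_left mob_image_inverse_right\<close>)

text \<open>
  The value 0 outside \<open>\<H>\<close> is the normalisation in \<^const>\<open>M0\<close>. At a point with infinitely
  many adjacent chambers the conventions for \<^const>\<open>card\<close> and \<^const>\<open>sum\<close> would make both this
  expression and \<^const>\<open>average\<close> equal to 0, so the two can be compared at every point of \<open>\<H>\<close>.
\<close>

definition chamber_average :: "int \<Rightarrow> (complex set \<Rightarrow> complex) \<Rightarrow> complex \<Rightarrow> complex"
  where "chamber_average D v \<tau> = (if \<tau> \<in> \<H>
    then (1 / of_nat (card (adjacent_chambers D \<tau>))) * (\<Sum>C\<in>adjacent_chambers D \<tau>. v C) else 0)"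

lemma chamber_average_on_chamber:
  "C \<in> chambers D \<Longrightarrow> \<tau> \<in> C \<Longrightarrow> chamber_average D v \<tau> = v C"
  using chamber_subset[of C D] by (auto simp: chamber_average_def adjacent_chambers_of_chamber)

lemma tendsto_within_chamber:
  assumes "\<And>z. z \<in> C \<Longrightarrow> f z = k"
  shows "(f \<longlongrightarrow> k) (at \<tau> within C)"
  using assms by (intro tendsto_eventually) (auto simp: eventually_at_filter)

text \<open>
  As a chamber is open, each point of its closure is a limit point, so the filter is nontrivial and
  the limit is unique.
\<close>

lemma Lim_within_chamber:
  assumes C: "C \<in> chambers D" and \<tau>: "\<tau> \<in> closure C" and f: "\<And>z. z \<in> C \<Longrightarrow> f z = k"
  shows "Lim (at \<tau> within C) f = k"
proof -
  have "\<tau> islimpt C"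
    using \<tau> open_chamber[OF C] interior_limit_point interior_open by (metis UnE closure_def mem_Collect_eq)
  then have "\<not> trivial_limit (at \<tau> within C)" by (simp add: trivial_limit_within)
  then show ?thesis using tendsto_within_chamber[of C f k, OF f] by (rule tendsto_Lim)
qed

definition invariant_on_chambers :: "int \<Rightarrow> (complex set \<Rightarrow> complex) \<Rightarrow> bool"
  where "invariant_on_chambers D v \<longleftrightarrow> (\<forall>\<gamma>\<in>SL2Z. \<forall>C\<in>chambers D. v (mob \<gamma> ` C) = v C)"

text \<open>
  On a chamber \<open>C\<close> the average is \<open>v C\<close>, so averaging a second time, through the limits, changes
  nothing. Invariance holds as \<open>\<gamma>\<close> maps the chambers adjacent to \<open>\<tau>\<close> bijectively to those adjacent
  to \<open>\<gamma>\<tau>\<close>.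
\<close>

lemma chamber_average_in_M0:
  assumes v: "invariant_on_chambers D v"
  shows "chamber_average D v \<in> M0 D"
proof -
  let ?E = "exceptional_set D" and ?f = "chamber_average D v"
  have inv: "?f (mob \<gamma> \<tau>) = ?f \<tau>" if \<gamma>: "\<gamma> \<in> SL2Z" and \<tau>: "\<tau> \<in> \<H>" for \<gamma> \<tau>
  proof -
    note bij = bij_betw_adjacent_chambers[OF \<gamma> \<tau>, of D]
    have "(\<Sum>C\<in>adjacent_chambers D (mob \<gamma> \<tau>). v C) = (\<Sum>C\<in>adjacent_chambers D \<tau>. v (mob \<gamma> ` C))"
      using sum.reindex_bij_betw[OF bij, of v] by simp
    also have "\<dots> = (\<Sum>C\<in>adjacent_chambers D \<tau>. v C)"
      using v \<gamma> by (intro sum.cong) (auto simp: invariant_on_chambers_def adjacent_chambers_eq)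
    finally show ?thesis
      using bij_betw_same_card[OF bij] \<tau> mob_in_upper_half_plane[OF \<gamma> \<tau>]
      unfolding chamber_average_def by simp
  qed
  have "local_polynomial ?E ?f"
    unfolding local_polynomial_def chambers_def[symmetric]
  proof
    fix C assume "C \<in> chambers D"
    then show "\<exists>p. \<forall>\<tau>\<in>C. ?f \<tau> = poly p \<tau>"
      by (intro exI[of _ "[:v C:]"]) (simp add: chamber_average_on_chamber)
  qed
  moreover have "average_exists ?E ?f \<tau>" for \<tau>
    unfolding average_exists_def
  proof
    fix C assume "C \<in> adjacent_chambers D \<tau>"
    then show "\<exists>l. (?f \<longlongrightarrow> l) (at \<tau> within C)"
      by (intro exI[of _ "v C"] tendsto_within_chamber)
         (auto simp: adjacent_chambers_eq chamber_average_on_chamber)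
  qed
  moreover have "?f \<tau> = average ?E ?f \<tau>" if "\<tau> \<in> \<H>" for \<tau>
  proof -
    have "(\<Sum>C\<in>adjacent_chambers D \<tau>. Lim (at \<tau> within C) ?f) = (\<Sum>C\<in>adjacent_chambers D \<tau>. v C)"
      by (intro sum.cong refl Lim_within_chamber[of _ D])
         (auto simp: adjacent_chambers_eq chamber_average_on_chamber)
    then show ?thesis using that by (simp add: average_def chamber_average_def)
  qed
  ultimately show ?thesis
    using inv by (simp add: M0_def modular_local_polynomial_def) (simp add: chamber_average_def)
qed

lemma M0_is_chamber_average:
  assumes "f \<in> M0 D"
  shows "\<exists>v. invariant_on_chambers D v \<and> f = chamber_average D v"
proof -
  have f: "modular_local_polynomial (exceptional_set D) f" and f0: "\<And>\<tau>. \<tau> \<notin> \<H> \<Longrightarrow> f \<tau> = 0"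
    using assms unfolding M0_def by blast+
  have "\<forall>C\<in>chambers D. \<exists>k. \<forall>\<tau>\<in>C. f \<tau> = k"
    using modular_local_polynomial_constant_on_chamber[OF f] by (simp add: constant_on_def)
  then obtain v where v: "\<And>C \<tau>. C \<in> chambers D \<Longrightarrow> \<tau> \<in> C \<Longrightarrow> f \<tau> = v C" by metis
  have "v (mob \<gamma> ` C) = v C" if \<gamma>: "\<gamma> \<in> SL2Z" and C: "C \<in> chambers D" for \<gamma> C
  proof -
    obtain \<tau> where \<tau>: "\<tau> \<in> C" using chamber_nonempty[OF C] by blast
    then have "f (mob \<gamma> \<tau>) = f \<tau>"
      using f \<gamma> chamber_subset[OF C] unfolding modular_local_polynomial_def by blast
    then show ?thesis using v[OF C \<tau>] v[OF mob_image_chamber[OF \<gamma> C], of "mob \<gamma> \<tau>"] \<tau> by simp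
  qed
  moreover have "f \<tau> = chamber_average D v \<tau>" for \<tau>
  proof (cases "\<tau> \<in> \<H>")
    case True
    then have "f \<tau> = average (exceptional_set D) f \<tau>" using f unfolding modular_local_polynomial_def by blast
    also have "\<dots> = chamber_average D v \<tau>"
      using True unfolding average_def chamber_average_def
      by (auto simp: adjacent_chambers_eq v intro!: sum.cong Lim_within_chamber[of _ D])
    finally show ?thesis .
  qed (simp add: f0 chamber_average_def del: mem_upper_half_plane)
  ultimately show ?thesis unfolding invariant_on_chambers_def by blast
qed

lemma subspace_M0: "complex_fun.subspace (M0 D)"
proof (rule complex_fun.subspaceI)
  have "chamber_average D (\<lambda>_. 0) = 0" by (simp add: fun_eq_iff chamber_average_def)
  then show "0 \<in> M0 D"
    using chamber_average_in_M0[of D "\<lambda>_. 0"] by (simp add: invariant_on_chambers_def)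
next
  fix f g assume "f \<in> M0 D" "g \<in> M0 D"
  then obtain u v where uv: "invariant_on_chambers D u" "f = chamber_average D u"
    "invariant_on_chambers D v" "g = chamber_average D v"
    using M0_is_chamber_average by metis
  have "f + g = chamber_average D (\<lambda>C. u C + v C)"
    unfolding uv by (simp add: fun_eq_iff chamber_average_def sum.distrib algebra_simps)
  then show "f + g \<in> M0 D"
    using chamber_average_in_M0[of D "\<lambda>C. u C + v C"] uv by (simp add: invariant_on_chambers_def)
next
  fix k f assume "f \<in> M0 D"
  then obtain v where v: "invariant_on_chambers D v" "f = chamber_average D v"
    using M0_is_chamber_average by metis
  have "(\<lambda>\<tau>. k * f \<tau>) = chamber_average D (\<lambda>C. k * v C)"
    unfolding v by (simp add: fun_eq_iff chamber_average_def flip: sum_distrib_left)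
  then show "(\<lambda>\<tau>. k * f \<tau>) \<in> M0 D"
    using chamber_average_in_M0[of D "\<lambda>C. k * v C"] v by (simp add: invariant_on_chambers_def)
qed

section \<open>The dimension\<close>

definition orbit_function :: "int \<Rightarrow> complex set set \<Rightarrow> complex \<Rightarrow> complex"
  where "orbit_function D \<omega> = chamber_average D (\<lambda>C. of_bool (C \<in> \<omega>))"

lemma orbit_function_in_M0:
  assumes "\<omega> \<in> chamber_orbits D"
  shows "orbit_function D \<omega> \<in> M0 D"
  unfolding orbit_function_def
  by (rule chamber_average_in_M0)
     (simp add: invariant_on_chambers_def mem_chamber_orbits_iff[OF assms] mob_image_chamber
       chamber_orbit_mob_image)

lemma sum_orbit_function_on_chamber:
  assumes C: "C \<in> chambers D" and \<tau>: "\<tau> \<in> C"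
  shows "(\<Sum>\<omega>\<in>chamber_orbits D. k \<omega> * orbit_function D \<omega> \<tau>) = k (chamber_orbit C)"
proof -
  have "(\<Sum>\<omega>\<in>chamber_orbits D. k \<omega> * orbit_function D \<omega> \<tau>)
      = (\<Sum>\<omega>\<in>chamber_orbits D. if chamber_orbit C = \<omega> then k \<omega> else 0)"
    using C \<tau> by (intro sum.cong refl)
      (simp add: orbit_function_def chamber_average_on_chamber mem_chamber_orbits_iff)
  also have "\<dots> = k (chamber_orbit C)"
    using C by (simp add: finite_chamber_orbits) (simp add: chamber_orbits_def)
  finally show ?thesis .
qed

lemma sum_fun_apply: "(\<Sum>x\<in>A. f x) \<tau> = (\<Sum>x\<in>A. f x \<tau>)"
  by (induction A rule: infinite_finite_induct) auto

text \<open>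
  Averaging is linear in the values on chambers, and an invariant assignment of values is a linear
  combination of the indicators of the chamber orbits.
\<close>

lemma M0_subset_span: "M0 D \<subseteq> complex_fun.span (orbit_function D ` chamber_orbits D)"
proof
  fix f assume "f \<in> M0 D"
  then obtain v where v: "invariant_on_chambers D v" and f: "f = chamber_average D v"
    using M0_is_chamber_average by blast
  define k where "k \<omega> = v (SOME C. C \<in> \<omega>)" for \<omega>
  have k: "v C = (\<Sum>\<omega>\<in>chamber_orbits D. k \<omega> * of_bool (C \<in> \<omega>))" if C: "C \<in> chambers D" for C
  proof -
    obtain \<tau> where \<tau>: "\<tau> \<in> C" using chamber_nonempty[OF C] by blast
    have "(SOME B. B \<in> chamber_orbit C) \<in> chamber_orbit C" using chamber_orbit_refl by (rule someI)
    then have "v C = k (chamber_orbit C)"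
      using v C unfolding k_def by (auto simp: invariant_on_chambers_def chamber_orbit_def)
    then show ?thesis
      using sum_orbit_function_on_chamber[OF C \<tau>, of k] C \<tau>
      by (simp add: orbit_function_def chamber_average_on_chamber)
  qed
  have "f \<tau> = (\<Sum>\<omega>\<in>chamber_orbits D. k \<omega> * orbit_function D \<omega> \<tau>)" for \<tau>
  proof (cases "\<tau> \<in> \<H>")
    case True
    have "(\<Sum>C\<in>adjacent_chambers D \<tau>. v C)
        = (\<Sum>C\<in>adjacent_chambers D \<tau>. \<Sum>\<omega>\<in>chamber_orbits D. k \<omega> * of_bool (C \<in> \<omega>))"
      by (intro sum.cong refl k) (simp add: adjacent_chambers_eq)
    also have "\<dots> = (\<Sum>\<omega>\<in>chamber_orbits D. k \<omega> * (\<Sum>C\<in>adjacent_chambers D \<tau>. of_bool (C \<in> \<omega>)))"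
      by (subst sum.swap) (simp only: sum_distrib_left)
    finally show ?thesis
      using True unfolding f orbit_function_def chamber_average_def
      by (simp add: sum_distrib_left mult.left_commute del: sum_of_bool_eq)
  qed (simp add: f orbit_function_def chamber_average_def)
  then have "f = (\<Sum>\<omega>\<in>chamber_orbits D. (\<lambda>\<tau>. k \<omega> * orbit_function D \<omega> \<tau>))"
    by (simp add: fun_eq_iff sum_fun_apply)
  moreover have "\<dots> \<in> complex_fun.span (orbit_function D ` chamber_orbits D)"
    by (intro complex_fun.span_sum complex_fun.span_scale complex_fun.span_base imageI)
  ultimately show "f \<in> complex_fun.span (orbit_function D ` chamber_orbits D)" by simp
qed

lemma inj_on_orbit_function: "inj_on (orbit_function D) (chamber_orbits D)"
proof (rule inj_onI)
  fix \<omega> \<omega>' assume \<omega>: "\<omega> \<in> chamber_orbits D" "\<omega>' \<in> chamber_orbits D"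
    and eq: "orbit_function D \<omega> = orbit_function D \<omega>'"
  obtain C where C: "C \<in> chambers D" "\<omega> = chamber_orbit C" using \<omega> by (auto simp: chamber_orbits_def)
  obtain \<tau> where \<tau>: "\<tau> \<in> C" using chamber_nonempty[OF C(1)] by blast
  have "of_bool (C \<in> \<omega>) = (of_bool (C \<in> \<omega>') :: complex)"
    using fun_cong[OF eq, of \<tau>] C \<tau> by (simp add: orbit_function_def chamber_average_on_chamber)
  then show "\<omega> = \<omega>'" using C \<omega> by (simp add: mem_chamber_orbits_iff split: if_splits)
qed

lemma independent_orbit_functions:
  "complex_fun.independent (orbit_function D ` chamber_orbits D)"
proof (rule complex_fun.independent_if_scalars_zero)
  show "finite (orbit_function D ` chamber_orbits D)" by (simp add: finite_chamber_orbits)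
  fix k g
  assume zero: "(\<Sum>g\<in>orbit_function D ` chamber_orbits D. (\<lambda>\<tau>. k g * g \<tau>)) = 0"
    and "g \<in> orbit_function D ` chamber_orbits D"
  then obtain C where C: "C \<in> chambers D" "g = orbit_function D (chamber_orbit C)"
    by (auto simp: chamber_orbits_def)
  obtain \<tau> where \<tau>: "\<tau> \<in> C" using chamber_nonempty[OF C(1)] by blast
  have "(\<Sum>\<omega>\<in>chamber_orbits D. k (orbit_function D \<omega>) * orbit_function D \<omega> \<tau>) = 0"
    using fun_cong[OF zero, of \<tau>]
    by (simp add: sum_fun_apply sum.reindex[OF inj_on_orbit_function])
  then show "k g = 0" using sum_orbit_function_on_chamber[OF C(1) \<tau>] C(2) by simp
qed

theorem theorem1p2:
  fixes D :: int
  assumes "D > 0"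
  shows "complex_fun.subspace (M0 D) \<and>
    (\<exists>B. finite B \<and> B \<subseteq> M0 D \<and> M0 D \<subseteq> complex_fun.span B) \<and>
    (\<exists>F. is_arg_min (num_components D) fundamental_domain F \<and>
         enat (complex_fun.dim (M0 D)) = num_components D F)"
proof -
  let ?B = "orbit_function D ` chamber_orbits D"
  have B: "finite ?B" "?B \<subseteq> M0 D" using finite_chamber_orbits orbit_function_in_M0 by auto
  have "complex_fun.dim (M0 D) = card ?B"
    using B(2) M0_subset_span independent_orbit_functions by (rule complex_fun.dim_unique) simp
  then have dim: "complex_fun.dim (M0 D) = card (chamber_orbits D)"
    by (simp add: card_image inj_on_orbit_function)
  obtain F where F: "fundamental_domain F" "num_components D F = enat (card (chamber_orbits D))"
    using ex_fundamental_domain_num_components_le[of D] num_components_ge[of _ D] order_antisym by blast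
  then have "is_arg_min (num_components D) fundamental_domain F"
    using num_components_ge[of _ D] by (auto simp: is_arg_min_def not_less)
  moreover have "complex_fun.subspace (M0 D)" by (rule subspace_M0)
  ultimately show ?thesis using B M0_subset_span dim F by metis
qed

end
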